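(* Consider the regression model $Y_i=f_0(X_i)+\xi_i$, $i=1,\ldots,n$, without assuming independence between the $X_i$'s and the $\xi_i$'s, with $\mathcal{X}=\mathbb{R}$ and $P$ the law of $X_1$. For every triple $(\delta,\alpha,p)$ such that $\delta\in(0,1/2)$, $4\delta<\alpha<2$ and $2\le p<\min\{4/\delta,\,(2+4/\alpha)/(1+(1+2/\alpha)\delta)\}$, there exist - $X_i$'s and $\xi_i$'s satisfying: (i) the pairs $(X_i,\xi_i)$ are i.i.d.; (ii) $\xi_i$ is not independent of $X_i$, but $\mathbb{E}[\xi_1\mid X_1]=0$ and $\|\xi_1\|_{p,1}<\infty$; - a function class $\mathcal{F}\equiv\mathcal{F}_n$ and some $f_0\in\mathcal{F}$ with $\mathcal{F}-f_0$ satisfying the entropy condition with exponent $\alpha$, such that the following holds: for $n$ sufficiently large, there exists some least squares estimator $f_n^*\in\arg\min_{f\in\mathcal{F}_n}\frac1n\sum_{i=1}^n(Y_i-f(X_i))^2$ satisfying $$\mathbb{E}\|f_n^*-f_0\|_{L_2(P)}\ge\delta_n,$$ where $\delta_n\ge n^\beta\cdot\big(n^{-1/(2+\alpha)}\vee n^{-1/2+1/(2p)}\big)$ for some $\beta=\beta(\delta,\alpha,p)>0$.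
   Context: $\|\xi\|_{p,1}=\int_0^\infty\mathbb{P}(|\xi|>t)^{1/p}dt$; $\mathcal{F}-f_0=\{f-f_0:f\in\mathcal{F}\}$; $a\vee b=\max\{a,b\}$. Entropy condition with exponent $\alpha\in(0,2)$ for a class $\mathcal{H}$ with envelope $H(x)=\sup_{h\in\mathcal{H}}|h(x)|$: there is a constant $C$ (independent of $n$ when $\mathcal{H}$ depends on $n$) such that either (uniform entropy) for all $\epsilon>0$, $\sup_Q\log\mathcal{N}(\epsilon\|H\|_{L_2(Q)},\mathcal{H},L_2(Q))\le C\epsilon^{-\alpha}$, the supremum being over all finitely discrete probability measures $Q$ on $\mathcal{X}$ (with $\|H\|_{L_2(Q)}>0$); or (bracketing entropy) for all $\epsilon>0$, $\log\mathcal{N}_{[\,]}(\epsilon,\mathcal{H},L_2(P))\le C\epsilon^{-\alpha}$. Here $\mathcal{N}$ and $\mathcal{N}_{[\,]}$ are the covering and bracketing numbers. *)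

theory Defs
  imports "HOL-Probability.Probability"
begin

section \<open>Square-integrable functions\<close>

definition L2_space :: "'a measure \<Rightarrow> ('a \<Rightarrow> real) set" where
  "L2_space Q = {f \<in> borel_measurable Q. integrable Q (\<lambda>x. (f x)\<^sup>2)}"

text \<open>
  Only meaningful on \<^const>\<open>L2_space\<close>: the Bochner integral of a non-integrable function is 0,
  so membership in \<^const>\<open>L2_space\<close> is demanded wherever smallness of a norm is used.
\<close>

definition L2_norm :: "'a measure \<Rightarrow> ('a \<Rightarrow> real) \<Rightarrow> real" where
  "L2_norm Q f = sqrt (\<integral>x. (f x)\<^sup>2 \<partial>Q)"


section \<open>Covering numbers, bracketing numbers and the entropy condition\<close>

text \<open>
  Both numbers are \<open>\<infinity>\<close> if there is no finite cover.  Centres and brackets are square-integrable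
  but need not belong to the class; balls are open and brackets have size strictly below
  \<open>\<epsilon>\<close>.
\<close>

definition covering_number :: "real \<Rightarrow> ('a \<Rightarrow> real) set \<Rightarrow> 'a measure \<Rightarrow> enat" where
  "covering_number \<epsilon> H Q =
     (INF S \<in> {S. finite S \<and> S \<subseteq> L2_space Q \<and>
                 (\<forall>h\<in>H. \<exists>c\<in>S. (\<lambda>x. h x - c x) \<in> L2_space Q \<and> L2_norm Q (\<lambda>x. h x - c x) < \<epsilon>)}.
        enat (card S))"

definition bracketing_number :: "real \<Rightarrow> ('a \<Rightarrow> real) set \<Rightarrow> 'a measure \<Rightarrow> enat" where
  "bracketing_number \<epsilon> H Q =
     (INF B \<in> {B. finite B \<and> B \<subseteq> L2_space Q \<times> L2_space Q \<and>
                 (\<forall>(l, u)\<in>B. L2_norm Q (\<lambda>x. u x - l x) < \<epsilon>) \<and>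
                 (\<forall>h\<in>H. \<exists>(l, u)\<in>B. \<forall>x\<in>space Q. l x \<le> h x \<and> h x \<le> u x)}.
        enat (card B))"

definition ln_enat :: "enat \<Rightarrow> ereal" where
  "ln_enat N = (case N of enat k \<Rightarrow> ereal (ln (real k)) | \<infinity> \<Rightarrow> \<infinity>)"

definition envelope :: "('a \<Rightarrow> real) set \<Rightarrow> 'a \<Rightarrow> real" where
  "envelope H x = (SUP h\<in>H. \<bar>h x\<bar>)"

text \<open>
  Finitely discrete probability measures are the finitely supported pmfs.  The boundedness
  clause says that the envelope is finite, so that the real supremum is the intended one.
\<close>

definition uniform_entropy_bound :: "real \<Rightarrow> real \<Rightarrow> ('a \<Rightarrow> real) set \<Rightarrow> bool" where
  "uniform_entropy_bound C \<alpha> H \<longleftrightarrow>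
     (\<forall>x. bdd_above ((\<lambda>h. \<bar>h x\<bar>) ` H)) \<and>
     (\<forall>\<epsilon>>0. (SUP q \<in> {q. finite (set_pmf q) \<and> L2_norm (measure_pmf q) (envelope H) > 0}.
               ln_enat (covering_number (\<epsilon> * L2_norm (measure_pmf q) (envelope H)) H (measure_pmf q)))
             \<le> ereal (C * \<epsilon> powr (- \<alpha>)))"

definition bracketing_entropy_bound ::
  "real \<Rightarrow> real \<Rightarrow> ('a \<Rightarrow> real) set \<Rightarrow> 'a measure \<Rightarrow> bool" where
  "bracketing_entropy_bound C \<alpha> H P \<longleftrightarrow>
     (\<forall>\<epsilon>>0. ln_enat (bracketing_number \<epsilon> H P) \<le> ereal (C * \<epsilon> powr (- \<alpha>)))"

definition entropy_condition ::
  "real \<Rightarrow> 'a measure \<Rightarrow> (nat \<Rightarrow> ('a \<Rightarrow> real) set) \<Rightarrow> bool" where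
  "entropy_condition \<alpha> P H \<longleftrightarrow>
     (\<exists>C. (\<forall>n\<ge>1. uniform_entropy_bound C \<alpha> (H n)) \<or>
          (\<forall>n\<ge>1. bracketing_entropy_bound C \<alpha> (H n) P))"


section \<open>The norm \<open>\<parallel>\<xi>\<parallel>\<^sub>p\<^sub>,\<^sub>1\<close>\<close>

definition Lp1_norm :: "'w measure \<Rightarrow> real \<Rightarrow> ('w \<Rightarrow> real) \<Rightarrow> ennreal" where
  "Lp1_norm M p \<xi> =
     (\<integral>\<^sup>+t\<in>{0<..}. ennreal (measure M {w \<in> space M. \<bar>\<xi> w\<bar> > t} powr (1 / p)) \<partial>lborel)"


section \<open>Least squares estimation\<close>

text \<open>A data set of size \<open>n\<close> is an extensional family of pairs \<open>(x\<^sub>i, y\<^sub>i)\<close>, \<open>i \<in> {1..n}\<close>.\<close>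

abbreviation data_space :: "nat \<Rightarrow> (nat \<Rightarrow> real \<times> real) measure" where
  "data_space n \<equiv> (\<Pi>\<^sub>M i\<in>{1..n}. borel)"

definition empirical_loss :: "nat \<Rightarrow> (nat \<Rightarrow> real \<times> real) \<Rightarrow> (real \<Rightarrow> real) \<Rightarrow> real" where
  "empirical_loss n d f = 1 / real n * (\<Sum>i=1..n. (snd (d i) - f (fst (d i)))\<^sup>2)"

text \<open>
  Joint measurability makes the random function a genuine estimator and its
  \<open>L\<^sub>2(P)\<close>-distance to a fixed function a random variable.
\<close>

definition least_squares_estimator ::
  "nat \<Rightarrow> (real \<Rightarrow> real) set \<Rightarrow> ((nat \<Rightarrow> real \<times> real) \<Rightarrow> real \<Rightarrow> real) \<Rightarrow> bool" where
  "least_squares_estimator n F T \<longleftrightarrow>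
     (\<lambda>(d, x). T d x) \<in> borel_measurable (data_space n \<Otimes>\<^sub>M borel) \<and>
     (\<forall>d \<in> space (data_space n). is_arg_min (empirical_loss n d) (\<lambda>f. f \<in> F) (T d))"

definition regression_data ::
  "nat \<Rightarrow> (real \<Rightarrow> real) \<Rightarrow> (nat \<Rightarrow> 'w \<Rightarrow> real) \<Rightarrow> (nat \<Rightarrow> 'w \<Rightarrow> real) \<Rightarrow> 'w \<Rightarrow> nat \<Rightarrow> real \<times> real" where
  "regression_data n f0 X \<xi> w = (\<lambda>i\<in>{1..n}. (X i w, f0 (X i w) + \<xi> i w))"


section \<open>Assumptions on covariates and errors\<close>

definition iid_sequence :: "'w measure \<Rightarrow> (nat \<Rightarrow> 'w \<Rightarrow> 'b::topological_space) \<Rightarrow> bool" where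
  "iid_sequence M Z \<longleftrightarrow>
     prob_space.indep_vars M (\<lambda>_. borel) Z {1..} \<and>
     (\<forall>i\<ge>1. distr M borel (Z i) = distr M borel (Z 1))"

definition cond_mean_zero :: "'w measure \<Rightarrow> ('w \<Rightarrow> real) \<Rightarrow> ('w \<Rightarrow> real) \<Rightarrow> bool" where
  "cond_mean_zero M X \<xi> \<longleftrightarrow>
     integrable M \<xi> \<and>
     (AE w in M. real_cond_exp M (vimage_algebra (space M) X borel) \<xi> w = 0)"

end

theory Submission
  imports Defs "HOL-Real_Asymp.Real_Asymp"
begin

text \<open>
  When the errors may depend on the covariates, the large errors can be concentrated in a small
  region of the design, and a function supported in that region then fits nothing but noise.

  Take \<open>X\<close> uniform on \<open>(0, 1)\<close> and \<open>\<xi> = \<sigma> X\<^sup>-\<^sup>\<gamma>\<close> with a random sign \<open>\<sigma>\<close> independent of \<open>X\<close>.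
  The sign makes the conditional mean vanish, and \<open>\<bar>\<xi>\<bar>\<close> has the tail \<open>t\<^sup>-\<^sup>1\<^sup>/\<^sup>\<gamma>\<close>, so that
  \<open>\<parallel>\<xi>\<parallel>\<^sub>p\<^sub>,\<^sub>1\<close> is finite as soon as \<open>\<gamma> < 1 / p\<close>.  Let \<open>f\<^sub>0 = 0\<close> and \<open>F\<^sub>n = {0, g\<^sub>n}\<close>, where the spike
  \<open>g\<^sub>n\<close> has height \<open>n\<^sup>\<gamma>\<close> on \<open>(0, 1 / n)\<close> and vanishes elsewhere.

  Among \<open>n\<close> observations, about one falls into \<open>(0, 1 / n)\<close>, and every error made there exceeds
  \<open>n\<^sup>\<gamma>\<close> in absolute value.  If there is such an observation and all of them have positive errors,
  replacing the fit \<open>0\<close> by \<open>g\<^sub>n\<close> moves each of these fitted values towards the response without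
  overshooting, so every least squares estimator equals \<open>g\<^sub>n\<close>.  This happens with probability
  \<open>(1 - 1/(2n))\<^sup>n - (1 - 1/n)\<^sup>n \<ge> 1/2 - 1/e\<close>, which bounds the risk from below by a constant times
  \<open>\<parallel>g\<^sub>n\<parallel> = n\<^sup>\<gamma>\<^sup>-\<^sup>1\<^sup>/\<^sup>2\<close> (lemma \<open>least_squares_risk_spike\<close>).

  As \<open>\<gamma>\<close> approaches \<open>1 / p\<close>, the exponent approaches \<open>1/p - 1/2\<close>.  It lies above \<open>-1/2 + 1/(2p)\<close>
  because \<open>p\<close> is positive, and above \<open>-1/(2 + \<alpha>)\<close> exactly when \<open>p < 2 + 4/\<alpha>\<close>, which follows from the
  upper bound on \<open>p\<close>.  This leaves room for a factor \<open>n\<^sup>\<beta>\<close>.  The entropy of a class of two functions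
  is at most \<open>ln 2\<close> at every radius, and \<open>0\<close> once the radius exceeds the norm of the envelope; so the
  entropy condition holds uniformly in the height of the spike (lemma \<open>uniform_entropy_bound_pair\<close>).
\<close>

section \<open>Least squares over two functions\<close>

lemma ln_enat_covering_number_le:
  assumes "finite S" "S \<noteq> {}" "S \<subseteq> L2_space Q" "card S \<le> m"
    and "\<forall>h\<in>H. \<exists>c\<in>S. (\<lambda>x. h x - c x) \<in> L2_space Q \<and> L2_norm Q (\<lambda>x. h x - c x) < \<epsilon>"
  shows "ln_enat (covering_number \<epsilon> H Q) \<le> ereal (ln (real m))"
proof -
  have "covering_number \<epsilon> H Q \<le> enat (card S)"
    unfolding covering_number_def using assms by (intro INF_lower) auto
  then obtain k where k: "covering_number \<epsilon> H Q = enat k" "k \<le> card S"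
    by (cases "covering_number \<epsilon> H Q") auto
  have "1 \<le> m"
    using assms by (metis One_nat_def Suc_leI card_gt_0_iff le_trans)
  with k assms have "ln (real k) \<le> ln (real m)"
    by (cases "k = 0") auto
  with k show ?thesis by (simp add: ln_enat_def)
qed

text \<open>
  The constant does not depend on \<open>g\<close>: for \<open>\<epsilon> \<le> 1\<close> the two functions themselves form a cover and
  \<open>\<epsilon>\<^sup>-\<^sup>\<alpha> \<ge> 1\<close>; for \<open>\<epsilon> > 1\<close> the envelope is \<open>\<bar>g\<bar>\<close>, so the single centre \<open>0\<close> covers both and the
  logarithm of the covering number vanishes, as it must for the bound to hold for large \<open>\<epsilon>\<close>.
\<close>

lemma uniform_entropy_bound_pair:
  assumes "0 < \<alpha>"
  shows "uniform_entropy_bound (ln 2) \<alpha> {\<lambda>_. 0, g}"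
  unfolding uniform_entropy_bound_def
proof (intro conjI allI impI SUP_least)
  let ?H = "{\<lambda>_. 0, g}"
  fix \<epsilon> :: real and q
  assume \<epsilon>: "0 < \<epsilon>"
    and "q \<in> {q. finite (set_pmf q) \<and> 0 < L2_norm (measure_pmf q) (envelope ?H)}"
  then have fin: "finite (set_pmf q)" and pos: "0 < L2_norm (measure_pmf q) (envelope ?H)"
    by auto
  have env: "envelope ?H = (\<lambda>x. \<bar>g x\<bar>)"
    by (auto simp: envelope_def fun_eq_iff cSup_eq_Max)
  let ?N = "L2_norm (measure_pmf q) g"
  have N: "L2_norm (measure_pmf q) (envelope ?H) = ?N"
    by (simp add: env L2_norm_def)
  have L2: "f \<in> L2_space (measure_pmf q)" for f
    using fin by (simp add: L2_space_def integrable_measure_pmf_finite)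
  have L2_0: "L2_norm (measure_pmf q) (\<lambda>_. 0) = 0"
    by (simp add: L2_norm_def)
  show "ln_enat (covering_number (\<epsilon> * L2_norm (measure_pmf q) (envelope ?H)) ?H (measure_pmf q))
          \<le> ereal (ln 2 * \<epsilon> powr - \<alpha>)"
  proof (cases "\<epsilon> \<le> 1")
    case True
    then have "1 \<le> \<epsilon> powr - \<alpha>"
      using \<epsilon> assms powr_mono2'[of "- \<alpha>" \<epsilon> 1] by simp
    have "ln_enat (covering_number (\<epsilon> * ?N) ?H (measure_pmf q)) \<le> ereal (ln (real 2))"
      using \<epsilon> pos
      by (intro ln_enat_covering_number_le[where S = ?H])
         (auto simp: L2 N L2_0 card_insert_if)
    also have "\<dots> \<le> ereal (ln 2 * \<epsilon> powr - \<alpha>)"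
      using \<open>1 \<le> \<epsilon> powr - \<alpha>\<close> by simp
    finally show ?thesis unfolding N .
  next
    case False
    then have "?N < \<epsilon> * ?N"
      using pos N by simp
    have "ln_enat (covering_number (\<epsilon> * ?N) ?H (measure_pmf q)) \<le> ereal (ln (real 1))"
      using \<epsilon> pos \<open>?N < \<epsilon> * ?N\<close>
      by (intro ln_enat_covering_number_le[where S = "{\<lambda>_. 0}"]) (auto simp: L2 N L2_0)
    also have "\<dots> \<le> ereal (ln 2 * \<epsilon> powr - \<alpha>)"
      by simp
    finally show ?thesis unfolding N .
  qed
qed auto

lemma ex_least_squares_estimator_pair:
  assumes [measurable]: "g \<in> borel_measurable borel" "h \<in> borel_measurable borel"
  shows "\<exists>T. least_squares_estimator n {g, h} T"
proof -
  define T where "T d = (if empirical_loss n d g \<le> empirical_loss n d h then g else h)" for d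
  have [measurable]: "(\<lambda>d. empirical_loss n d f) \<in> borel_measurable (data_space n)"
    if [measurable]: "f \<in> borel_measurable borel" for f :: "real \<Rightarrow> real"
  proof -
    have [measurable]: "(\<lambda>d. fst (d i)) \<in> borel_measurable (data_space n)"
      "(\<lambda>d. snd (d i)) \<in> borel_measurable (data_space n)" if "i \<in> {1..n}" for i
      by (rule measurable_compose[OF measurable_component_singleton[OF that]];
          simp add: borel_prod[symmetric])+
    show ?thesis
      unfolding empirical_loss_def by measurable
  qed
  have "(\<lambda>(d, x). T d x) =
      (\<lambda>(d, x). if empirical_loss n d g \<le> empirical_loss n d h then g x else h x)"
    by (auto simp: T_def)
  also have "\<dots> \<in> borel_measurable (data_space n \<Otimes>\<^sub>M borel)"
    by measurable
  finally have "(\<lambda>(d, x). T d x) \<in> borel_measurable (data_space n \<Otimes>\<^sub>M borel)" .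
  then have "least_squares_estimator n {g, h} T"
    by (auto simp: least_squares_estimator_def is_arg_min_def T_def)
  then show ?thesis by blast
qed

lemma least_squares_estimator_pair_eq:
  assumes "least_squares_estimator n {h, g} T" "d \<in> space (data_space n)"
    and "empirical_loss n d g < empirical_loss n d h"
  shows "T d = g"
  using assms by (auto simp: least_squares_estimator_def is_arg_min_def)

text \<open>
  Fitting \<open>a\<close> instead of \<open>0\<close> to a response \<open>y\<close> reduces the squared residual whenever
  \<open>0 < a \<le> y\<close>.  One such observation makes the comparison strict.
\<close>

lemma empirical_loss_less_zero_fit:
  assumes le: "\<And>i. i \<in> {1..n} \<Longrightarrow> g (fst (d i)) = 0 \<or> 0 < g (fst (d i)) \<and> g (fst (d i)) \<le> snd (d i)"
    and ex: "\<exists>i\<in>{1..n}. g (fst (d i)) \<noteq> 0"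
  shows "empirical_loss n d g < empirical_loss n d (\<lambda>_. 0)"
proof -
  have square: "(y - a)\<^sup>2 < y\<^sup>2" if "0 < a" "a \<le> y" for a y :: real
    using that by (intro power_strict_mono) auto
  have "(\<Sum>i=1..n. (snd (d i) - g (fst (d i)))\<^sup>2) < (\<Sum>i=1..n. (snd (d i) - 0)\<^sup>2)"
  proof (rule sum_strict_mono_ex1)
    show "\<forall>i\<in>{1..n}. (snd (d i) - g (fst (d i)))\<^sup>2 \<le> (snd (d i) - 0)\<^sup>2"
      using le square by (metis diff_zero less_eq_real_def)
    show "\<exists>i\<in>{1..n}. (snd (d i) - g (fst (d i)))\<^sup>2 < (snd (d i) - 0)\<^sup>2"
      using ex le square by (metis diff_zero)
  qed simp
  moreover have "0 < n" using ex by auto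
  ultimately show ?thesis
    by (simp add: empirical_loss_def divide_strict_right_mono)
qed

section \<open>Independent samples\<close>

text \<open>
  The event is the difference of two events that constrain every observation separately, ``none
  is bad'' and ``none is bad or good'', so independence gives its exact probability.
\<close>

lemma prob_some_good_none_bad:
  assumes "prob_space K" and [measurable]: "G \<in> sets K" "B \<in> sets K" and "G \<inter> B = {}"
  defines "M \<equiv> (\<Pi>\<^sub>M i\<in>(UNIV :: nat set). K)"
  shows "measure M {w \<in> space M. (\<exists>i\<in>{1..n}. w i \<in> G) \<and> (\<forall>i\<in>{1..n}. w i \<notin> B)}
           = (1 - measure K B) ^ n - (1 - measure K B - measure K G) ^ n"
proof -
  interpret K: prob_space K by fact
  interpret PM: product_prob_space "\<lambda>_::nat. K" UNIV by unfold_locales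
  have [measurable]: "(\<lambda>w. w i) \<in> measurable M K" for i
    by (simp add: M_def)
  have all: "measure M {w \<in> space M. \<forall>i\<in>{1..n}. w i \<in> C} = measure K C ^ n"
    if "C \<in> sets K" for C
    using PM.emeasure_PiM_Collect[of "{1..n}" "\<lambda>_. C"] that
    by (simp add: M_def K.emeasure_eq_measure PM.emeasure_eq_measure ennreal_power)
  let ?S = "{w \<in> space M. \<forall>i\<in>{1..n}. w i \<in> space K - B}"
  let ?R = "{w \<in> space M. \<forall>i\<in>{1..n}. w i \<in> space K - (B \<union> G)}"
  have "{w \<in> space M. (\<exists>i\<in>{1..n}. w i \<in> G) \<and> (\<forall>i\<in>{1..n}. w i \<notin> B)} = ?S - ?R"
    by (auto simp: M_def space_PiM PiE_iff)
  also have "measure M (?S - ?R) = measure M ?S - measure M ?R"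
    unfolding M_def by (rule PM.finite_measure_Diff) (auto simp flip: M_def)
  also have "measure M ?S = (1 - measure K B) ^ n"
    by (subst all) (auto simp: K.prob_compl)
  also have "measure M ?R = (1 - measure K B - measure K G) ^ n"
    using assms by (subst all) (auto simp: K.prob_compl K.finite_measure_Union Int_commute algebra_simps)
  finally show ?thesis .
qed

text \<open>
  Weak \<open>L\<^sub>q\<close> is contained in the Lorentz space \<open>L\<^sub>p\<^sub>,\<^sub>1\<close> for \<open>p < q\<close> over a probability space: the
  integrand is at most \<open>1\<close> on \<open>(0, 1)\<close> and at most the integrable function \<open>t\<^sup>-\<^sup>q\<^sup>/\<^sup>p\<close> beyond.
\<close>

lemma Lp1_norm_finite_if_tail_le:
  assumes "prob_space M" and "0 < p" "p < q"
    and tail: "\<And>t. 1 \<le> t \<Longrightarrow> measure M {w \<in> space M. \<bar>\<xi> w\<bar> > t} \<le> t powr (- q)"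
  shows "Lp1_norm M p \<xi> < \<infinity>"
proof -
  interpret prob_space M by fact
  have le: "ennreal (measure M {w \<in> space M. \<bar>\<xi> w\<bar> > t} powr (1 / p)) * indicator {0<..} t
      \<le> indicator {0..<1} t + ennreal (t powr (- q / p)) * indicator {1..} t" for t
  proof (cases "1 \<le> t")
    case True
    have "measure M {w \<in> space M. \<bar>\<xi> w\<bar> > t} powr (1 / p) \<le> (t powr (- q)) powr (1 / p)"
      using tail[OF True] \<open>0 < p\<close> by (intro powr_mono2) auto
    also have "\<dots> = t powr (- q / p)"
      by (simp add: powr_powr)
    finally show ?thesis
      using True by (simp add: indicator_def ennreal_leI)
  next
    case False
    have "measure M {w \<in> space M. \<bar>\<xi> w\<bar> > t} powr (1 / p) \<le> 1"
      using \<open>0 < p\<close> by (intro powr_le1) auto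
    then show ?thesis
      using False by (auto simp: indicator_def)
  qed
  have "Lp1_norm M p \<xi> \<le>
      (\<integral>\<^sup>+t. indicator {0..<1} t + ennreal (t powr (- q / p)) * indicator {1..} t \<partial>lborel)"
    unfolding Lp1_norm_def by (intro nn_integral_mono le)
  also have "\<dots> = 1 + (\<integral>\<^sup>+t. ennreal (t powr (- q / p)) * indicator {1..} t \<partial>lborel)"
    by (subst nn_integral_add) auto
  also have "\<dots> < \<infinity>"
    using nn_integral_has_integral_lebesgue'[OF _ has_integral_powr_to_inf[of "- q / p" 1]]
      \<open>0 < p\<close> \<open>p < q\<close> by (simp add: field_simps)
  finally show ?thesis .
qed

section \<open>Symmetric noise that grows near a point of the design\<close>

text \<open>
  An observation is generated by a pair of coordinates: the first is the covariate, and only the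
  sign of the second enters the error.
\<close>

definition heavy_noise :: "real \<Rightarrow> real \<times> real \<Rightarrow> real" where
  "heavy_noise \<gamma> z = (if 0 < snd z then 1 else -1) * fst z powr (- \<gamma>)"

definition design_law :: "real measure" where
  "design_law = uniform_measure lborel {0<..<1}"

definition sign_law :: "real measure" where
  "sign_law = uniform_measure lborel {-1<..<1}"

definition observation_law :: "(real \<times> real) measure" where
  "observation_law = design_law \<Otimes>\<^sub>M sign_law"

definition sample_law :: "(nat \<Rightarrow> real \<times> real) measure" where
  "sample_law = (\<Pi>\<^sub>M i\<in>UNIV. observation_law)"

interpretation design: prob_space design_law
  unfolding design_law_def by (rule prob_space_uniform_measure) auto

interpretation sign: prob_space sign_law
  unfolding sign_law_def by (rule prob_space_uniform_measure) auto

interpretation design_sign: pair_prob_space design_law sign_law ..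

interpretation observation: prob_space observation_law
  unfolding observation_law_def by (rule prob_space_pair) unfold_locales

interpretation sample: product_prob_space "\<lambda>_. observation_law" "UNIV :: nat set"
  rewrites "Pi\<^sub>M (UNIV :: nat set) (\<lambda>_. observation_law) = sample_law"
  by unfold_locales (simp add: sample_law_def)

lemma sets_design_law [measurable_cong, simp]: "sets design_law = sets borel"
  by (simp add: design_law_def)

lemma sets_sign_law [measurable_cong, simp]: "sets sign_law = sets borel"
  by (simp add: sign_law_def)

lemma sets_observation_law [measurable_cong, simp]: "sets observation_law = sets borel"
  unfolding observation_law_def borel_prod[symmetric] by (rule sets_pair_measure_cong) simp_all

lemma space_observation_law [simp]: "space observation_law = UNIV"
  using sets_eq_imp_space_eq[OF sets_observation_law] by simp

lemma space_sample_law [simp]: "space sample_law = UNIV"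
  by (simp add: sample_law_def space_PiM PiE_def Pi_def)

lemma measurable_coordinate [measurable]: "(\<lambda>w. w i) \<in> measurable sample_law observation_law"
  by (simp add: sample_law_def)

lemma borel_measurable_fst_snd [measurable]:
  "fst \<in> borel_measurable observation_law" "snd \<in> borel_measurable observation_law"
  unfolding observation_law_def by measurable

lemma measurable_fst_design_law [measurable]: "fst \<in> measurable observation_law design_law"
  unfolding observation_law_def by (rule measurable_fst)

lemma borel_measurable_heavy_noise [measurable]:
  "heavy_noise \<gamma> \<in> borel_measurable observation_law"
  unfolding heavy_noise_def by measurable

lemma measure_design_law_interval:
  assumes "0 \<le> t" "t \<le> 1"
  shows "measure design_law {0<..<t} = t"
proof -
  have "{0<..<1} \<inter> {0<..<t} = {0<..<t}" using assms by auto
  then show ?thesis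
    using assms by (simp add: design_law_def)
qed

lemma measure_sign_law_halves:
  "measure sign_law {0<..} = 1 / 2" "measure sign_law {..0} = 1 / 2"
proof -
  have "{-1<..<1} \<inter> {0<..} = {0<..<1::real}" "{-1<..<1} \<inter> {..0} = {-1<..0::real}" by auto
  then show "measure sign_law {0<..} = 1 / 2" "measure sign_law {..0} = 1 / 2"
    by (simp_all add: sign_law_def)
qed

lemma measure_observation_law_Times:
  assumes "A \<in> sets borel" "B \<in> sets borel"
  shows "measure observation_law (A \<times> B) = measure design_law A * measure sign_law B"
  using assms
  by (simp add: observation_law_def measure_def sign.emeasure_pair_measure_Times enn2real_mult)

lemma distr_sample_law_coordinate: "distr sample_law observation_law (\<lambda>w. w i) = observation_law"
  using sample.PiM_component[of i] by simp

lemma distr_observation_law_fst: "distr observation_law design_law fst = design_law"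
  unfolding observation_law_def by (rule sign.distr_pair_fst)

lemma distr_design: "distr sample_law borel (\<lambda>w. fst (w i)) = design_law"
proof -
  have "distr sample_law borel (\<lambda>w. fst (w i)) =
      distr (distr sample_law observation_law (\<lambda>w. w i)) design_law fst"
    by (subst distr_distr) (auto simp: comp_def intro!: distr_cong)
  then show ?thesis
    by (simp add: distr_sample_law_coordinate distr_observation_law_fst)
qed

lemma measure_sample_law_coordinate:
  assumes "A \<in> sets observation_law"
  shows "measure sample_law {w. w i \<in> A} = measure observation_law A"
  using sample.emeasure_PiM_Collect_single[of i A] assms by (simp add: measure_def)

text \<open>
  The joint law of the coordinates is the product measure itself, so the coordinates are
  independent; each observation depends on its own coordinate only.
\<close>

lemma iid_heavy_noise: "iid_sequence sample_law (\<lambda>i w. (fst (w i), heavy_noise \<gamma> (w i)))"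
proof -
  have rv: "(\<lambda>z. (fst z, heavy_noise \<gamma> z)) \<in> measurable observation_law borel"
    by measurable
  have "sample.indep_vars (\<lambda>_. observation_law) (\<lambda>i w. w i) UNIV"
  proof (subst sample.indep_vars_iff_distr_eq_PiM')
    show "distr sample_law (\<Pi>\<^sub>M i\<in>UNIV. observation_law) (\<lambda>w. \<lambda>i\<in>UNIV. w i) =
        (\<Pi>\<^sub>M i\<in>UNIV. distr sample_law observation_law (\<lambda>w. w i))"
      by (simp add: distr_sample_law_coordinate restrict_UNIV distr_id2 flip: sample_law_def)
  qed auto
  then have "sample.indep_vars (\<lambda>_. observation_law) (\<lambda>i w. w i) {1..}"
    by (rule sample.indep_vars_subset) simp
  then have "sample.indep_vars (\<lambda>_. borel) (\<lambda>i w. (fst (w i), heavy_noise \<gamma> (w i))) {1..}"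
    by (rule sample.indep_vars_compose2) (rule rv)
  moreover have "distr sample_law borel (\<lambda>w. (fst (w i), heavy_noise \<gamma> (w i))) =
      distr observation_law borel (\<lambda>z. (fst z, heavy_noise \<gamma> z))" for i
    using distr_distr[OF rv measurable_coordinate[of i]]
    by (simp add: distr_sample_law_coordinate comp_def)
  ultimately show ?thesis
    unfolding iid_sequence_def by simp
qed

lemma integrable_heavy_noise:
  assumes "\<gamma> < 1"
  shows "integrable observation_law (heavy_noise \<gamma>)"
proof -
  have "((\<lambda>x. x powr (- \<gamma>)) has_integral 1 / (1 - \<gamma>)) {0..1::real}"
    using has_integral_powr_from_0[of "- \<gamma>" 1] assms by (simp add: add.commute)
  then have fin: "(\<integral>\<^sup>+x. ennreal (x powr (- \<gamma>)) * indicator {0..1} x \<partial>lborel) < \<infinity>"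
    by (subst nn_integral_has_integral_lebesgue') auto
  have "(\<integral>\<^sup>+x. ennreal (x powr (- \<gamma>)) \<partial>design_law) =
      (\<integral>\<^sup>+x. ennreal (x powr (- \<gamma>)) * indicator {0<..<1} x \<partial>lborel)"
    unfolding design_law_def by (subst nn_integral_uniform_measure) (auto simp: divide_ennreal_def)
  also have "\<dots> \<le> (\<integral>\<^sup>+x. ennreal (x powr (- \<gamma>)) * indicator {0..1} x \<partial>lborel)"
    by (intro nn_integral_mono mult_left_mono) (auto simp: indicator_def)
  finally have "integrable design_law (\<lambda>x. x powr (- \<gamma>))"
    using fin by (intro integrableI_bounded) (auto intro: le_less_trans)
  then have "integrable observation_law (\<lambda>z. fst z powr (- \<gamma>))"
    using integrable_distr_eq[of fst observation_law design_law "\<lambda>x. x powr (- \<gamma>)"]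
    by (simp add: distr_observation_law_fst)
  then show ?thesis
    by (rule Bochner_Integration.integrable_bound) (auto simp: heavy_noise_def)
qed

lemma integral_sign_law: "(\<integral>s. (if 0 < s then 1 else -1 :: real) \<partial>sign_law) = 0"
proof -
  have "(\<integral>s. (if 0 < s then 1 else -1 :: real) \<partial>sign_law) =
      (\<integral>s. 2 * indicator {0<..} s - 1 \<partial>sign_law)"
    by (intro Bochner_Integration.integral_cong) (auto simp: indicator_def)
  also have "\<dots> = 2 * measure sign_law {0<..} - 1"
    by (subst Bochner_Integration.integral_diff) (auto simp: sign.emeasure_eq_measure sign.prob_space)
  finally show ?thesis
    by (simp add: measure_sign_law_halves)
qed

text \<open>
  The error is uncorrelated with the indicator of every event \<open>X \<in> B\<close>, because integrating out the
  sign first, by Fubini's theorem, already gives \<open>0\<close>.  These events generate the \<open>\<sigma>\<close>-algebra of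
  \<open>X\<close>, so this is what vanishing of the conditional mean amounts to.
\<close>

lemma integral_heavy_noise_times:
  assumes "\<gamma> < 1" and B: "B \<in> sets borel"
  shows "(\<integral>z. indicator B (fst z) * heavy_noise \<gamma> z \<partial>observation_law) = 0"
proof -
  have [measurable]: "B \<in> sets borel" by fact
  have int: "integrable observation_law (\<lambda>z. indicator B (fst z) * heavy_noise \<gamma> z)"
    by (rule Bochner_Integration.integrable_bound[OF integrable_heavy_noise[OF \<open>\<gamma> < 1\<close>]])
       (auto simp: indicator_def)
  have "(\<integral>z. indicator B (fst z) * heavy_noise \<gamma> z \<partial>observation_law) =
      (\<integral>x. (\<integral>s. indicator B x * heavy_noise \<gamma> (x, s) \<partial>sign_law) \<partial>design_law)"
    using design_sign.integral_fst'[OF int[unfolded observation_law_def]]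
    by (simp add: observation_law_def)
  also have "\<dots> = (\<integral>x. (\<integral>s. (if 0 < s then 1 else -1) * (indicator B x * x powr (- \<gamma>)) \<partial>sign_law)
      \<partial>design_law)"
    by (intro Bochner_Integration.integral_cong) (auto simp: heavy_noise_def)
  also have "\<dots> = 0"
    by (simp only: integral_mult_left_zero integral_sign_law) simp
  finally show ?thesis .
qed

lemma cond_mean_zero_heavy_noise:
  assumes "\<gamma> < 1"
  shows "cond_mean_zero sample_law (\<lambda>w. fst (w i)) (\<lambda>w. heavy_noise \<gamma> (w i))"
proof -
  let ?F = "vimage_algebra (space sample_law) (\<lambda>w. fst (w i)) borel"
  have X: "(\<lambda>w. fst (w i)) \<in> borel_measurable sample_law"
    by measurable
  have "subalgebra sample_law ?F"
    unfolding subalgebra_def using measurable_sets[OF X] by (auto simp: sets_vimage_algebra2)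
  then interpret finite_measure_subalgebra sample_law ?F
    by unfold_locales
  have int: "integrable sample_law (\<lambda>w. heavy_noise \<gamma> (w i))"
    using integrable_heavy_noise[OF assms]
      integrable_distr_eq[OF measurable_coordinate borel_measurable_heavy_noise, of i \<gamma>]
    by (simp add: distr_sample_law_coordinate)
  have "AE w in sample_law. real_cond_exp sample_law ?F (\<lambda>w. heavy_noise \<gamma> (w i)) w = 0"
  proof (rule real_cond_exp_charact)
    fix A assume "A \<in> sets ?F"
    then obtain B where B: "B \<in> sets borel" and A: "A = {w. fst (w i) \<in> B}"
      by (auto simp: sets_vimage_algebra2)
    have "(\<integral>w\<in>A. heavy_noise \<gamma> (w i) \<partial>sample_law) =
        (\<integral>w. indicator B (fst (w i)) * heavy_noise \<gamma> (w i) \<partial>sample_law)"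
      by (auto simp: set_lebesgue_integral_def A indicator_def intro!: Bochner_Integration.integral_cong)
    also have "\<dots> = (\<integral>z. indicator B (fst z) * heavy_noise \<gamma> z \<partial>distr sample_law observation_law (\<lambda>w. w i))"
      using B by (subst integral_distr) auto
    also have "\<dots> = 0"
      using integral_heavy_noise_times[OF assms B] by (simp add: distr_sample_law_coordinate)
    finally show "(\<integral>w\<in>A. heavy_noise \<gamma> (w i) \<partial>sample_law) = (\<integral>w\<in>A. 0 \<partial>sample_law)"
      by simp
  qed (use int in auto)
  with int show ?thesis
    by (simp add: cond_mean_zero_def)
qed

lemma measure_design_set:
  assumes "A \<in> sets borel"
  shows "measure observation_law {z. fst z \<in> A} = measure design_law A"
  using assms measure_distr[of fst observation_law design_law A]
  by (simp add: distr_observation_law_fst vimage_def)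

lemma AE_observation_design: "AE z in observation_law. 0 < fst z \<and> fst z < 1"
proof -
  have "AE x in design_law. 0 < x \<and> x < 1"
    unfolding design_law_def by (rule AE_uniform_measureI) auto
  then show ?thesis
    using AE_distr_iff[of fst observation_law design_law "\<lambda>x. 0 < x \<and> x < 1"]
    unfolding distr_observation_law_fst by simp
qed

lemma less_powr_minus_iff:
  fixes x t \<gamma> :: real
  assumes "0 < x" "0 < t" "0 < \<gamma>"
  shows "t < x powr (- \<gamma>) \<longleftrightarrow> x < t powr (- 1 / \<gamma>)"
proof -
  have "t < x powr (- \<gamma>) \<longleftrightarrow> ln t < ln (x powr (- \<gamma>))"
    using assms by (subst ln_less_cancel_iff) auto
  also have "\<dots> \<longleftrightarrow> ln x < (- 1 / \<gamma>) * ln t"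
    using assms by (auto simp: ln_powr field_simps)
  also have "\<dots> \<longleftrightarrow> ln x < ln (t powr (- 1 / \<gamma>))"
    using assms by (simp add: ln_powr)
  also have "\<dots> \<longleftrightarrow> x < t powr (- 1 / \<gamma>)"
    using assms by (subst ln_less_cancel_iff) auto
  finally show ?thesis .
qed

lemma abs_heavy_noise: "\<bar>heavy_noise \<gamma> z\<bar> = fst z powr (- \<gamma>)"
  by (simp add: heavy_noise_def)

lemma heavy_noise_tail:
  assumes "0 < \<gamma>" "1 \<le> t"
  shows "measure observation_law {z. \<bar>heavy_noise \<gamma> z\<bar> > t} = t powr (- 1 / \<gamma>)"
proof -
  let ?u = "t powr (- 1 / \<gamma>)"
  have iff: "t < x powr (- \<gamma>) \<longleftrightarrow> x < ?u" if "0 < x" for x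
    using less_powr_minus_iff[OF that] assms by simp
  have "measure observation_law {z. \<bar>heavy_noise \<gamma> z\<bar> > t} =
      measure observation_law {z. fst z \<in> {0<..<?u}}"
  proof (rule observation.finite_measure_eq_AE)
    show "AE z in observation_law. (z \<in> {z. \<bar>heavy_noise \<gamma> z\<bar> > t}) =
        (z \<in> {z. fst z \<in> {0<..<?u}})"
      using AE_observation_design
      by eventually_elim (simp add: abs_heavy_noise iff)
    show "{z. \<bar>heavy_noise \<gamma> z\<bar> > t} \<in> sets observation_law"
      using measurable_sets[of "\<lambda>z. \<bar>heavy_noise \<gamma> z\<bar>" observation_law borel "{t<..}"]
      by (simp add: vimage_def)
    show "{z. fst z \<in> {0<..<?u}} \<in> sets observation_law"
      using measurable_sets[of fst observation_law borel "{0<..<?u}"]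
      by (simp add: vimage_def)
  qed
  also have "\<dots> = measure design_law {0<..<?u}"
    by (rule measure_design_set) simp
  also have "\<dots> = ?u"
    using assms powr_mono[of "- 1 / \<gamma>" 0 t] by (intro measure_design_law_interval) auto
  finally show ?thesis .
qed

lemma measure_sample_noise:
  "measure sample_law {w. t < \<bar>heavy_noise \<gamma> (w i)\<bar>} = measure observation_law {z. t < \<bar>heavy_noise \<gamma> z\<bar>}"
proof -
  have "{z. t < \<bar>heavy_noise \<gamma> z\<bar>} \<in> sets observation_law"
    using measurable_sets[of "\<lambda>z. \<bar>heavy_noise \<gamma> z\<bar>" observation_law borel "{t<..}"]
    by (simp add: vimage_def)
  from measure_sample_law_coordinate[OF this, of i] show ?thesis by simp
qed

lemma Lp1_norm_heavy_noise:
  assumes "0 < p" "0 < \<gamma>" "\<gamma> < 1 / p"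
  shows "Lp1_norm sample_law p (\<lambda>w. heavy_noise \<gamma> (w i)) < \<infinity>"
proof (rule Lp1_norm_finite_if_tail_le)
  show "prob_space sample_law" by unfold_locales
  show "0 < p" by fact
  show "p < 1 / \<gamma>" using assms by (simp add: field_simps)
  show "measure sample_law {w \<in> space sample_law. t < \<bar>heavy_noise \<gamma> (w i)\<bar>} \<le> t powr - (1 / \<gamma>)"
    if "1 \<le> t" for t
    using heavy_noise_tail[OF \<open>0 < \<gamma>\<close> that] by (simp add: measure_sample_noise)
qed

text \<open>
  The size of the error is a decreasing function of the covariate.  Hence \<open>X < 1/2\<close> and
  \<open>\<bar>\<xi>\<bar> > 2\<^sup>\<gamma>\<close> are almost surely the same event; its probability is \<open>1/2\<close>, and not the \<open>1/4\<close> that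
  independence would give.
\<close>

lemma not_indep_heavy_noise:
  assumes "0 < \<gamma>"
  shows "\<not> sample.indep_var borel (\<lambda>w. fst (w i)) borel (\<lambda>w. heavy_noise \<gamma> (w i))"
proof
  let ?t = "2 powr \<gamma>"
  let ?A = "{0<..<1 / 2 :: real}" and ?B = "{y. ?t < \<bar>y\<bar>}"
  have [measurable]: "?A \<in> sets borel" "?B \<in> sets borel" by measurable
  assume "sample.indep_var borel (\<lambda>w. fst (w i)) borel (\<lambda>w. heavy_noise \<gamma> (w i))"
  from sample.indep_varD[OF this, of ?A ?B]
  have prod: "measure sample_law {w. fst (w i) \<in> ?A \<and> heavy_noise \<gamma> (w i) \<in> ?B} =
      measure sample_law {w. fst (w i) \<in> ?A} * measure sample_law {w. heavy_noise \<gamma> (w i) \<in> ?B}"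
    by (simp add: vimage_def)
  have one: "1 \<le> ?t" and half: "?t powr (- 1 / \<gamma>) = 1 / 2"
    using assms by (auto simp: powr_powr ge_one_powr_ge_zero powr_minus)
  have iff: "?t < x powr (- \<gamma>) \<longleftrightarrow> x < 1 / 2" if "0 < x" for x
    using less_powr_minus_iff[OF that, of ?t \<gamma>, unfolded half] assms by simp
  have A: "measure sample_law {w. fst (w i) \<in> ?A} = 1 / 2"
    using measure_distr[of "\<lambda>w. fst (w i)" sample_law borel ?A] measure_design_law_interval[of "1 / 2"]
    by (simp add: distr_design vimage_def)
  have B: "measure sample_law {w. heavy_noise \<gamma> (w i) \<in> ?B} = 1 / 2"
    using heavy_noise_tail[OF assms one] half by (simp add: measure_sample_noise)
  have "{w. fst (w i) \<in> ?A \<and> heavy_noise \<gamma> (w i) \<in> ?B} = {w. fst (w i) \<in> ?A}"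
    by (auto simp: abs_heavy_noise iff)
  with prod A B show False by simp
qed

section \<open>Overfitting a spike\<close>

definition spike :: "real \<Rightarrow> nat \<Rightarrow> real \<Rightarrow> real" where
  "spike \<gamma> n x = real n powr \<gamma> * indicator {0<..<1 / real n} x"

lemma borel_measurable_spike [measurable]: "spike \<gamma> n \<in> borel_measurable borel"
  unfolding spike_def by measurable

lemma spike_squared:
  "(spike \<gamma> n x)\<^sup>2 = (real n powr \<gamma>)\<^sup>2 * indicator {0<..<1 / real n} x"
  by (simp add: spike_def indicator_def)

lemma spike_in_L2_space: "spike \<gamma> n \<in> L2_space design_law"
  unfolding L2_space_def spike_squared
  by (auto simp: design.emeasure_eq_measure spike_squared)

lemma L2_norm_spike:
  assumes "1 \<le> n"
  shows "L2_norm design_law (spike \<gamma> n) = real n powr (\<gamma> - 1 / 2)"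
proof -
  have "L2_norm design_law (spike \<gamma> n) = sqrt ((real n powr \<gamma>)\<^sup>2 * (1 / real n))"
    using assms measure_design_law_interval[of "1 / real n"]
    by (simp add: L2_norm_def spike_squared)
  also have "\<dots> = real n powr (\<gamma> - 1 / 2)"
    using assms by (simp add: real_sqrt_mult real_sqrt_divide powr_diff powr_half_sqrt)
  finally show ?thesis .
qed

text \<open>
  The bound concerns every least squares estimator, since on the event used in the proof the
  spike has strictly smaller empirical loss than the zero function.  The observations in
  \<open>(0, 1/n)\<close> with positive sign are the good ones in the sense of
  \<open>prob_some_good_none_bad\<close>, those with nonpositive sign the bad ones; each kind has probability
  \<open>1/(2n)\<close>.
\<close>

lemma least_squares_risk_spike:
  assumes "0 < \<gamma>" "1 \<le> n" and T: "least_squares_estimator n {\<lambda>_. 0, spike \<gamma> n} T"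
  shows "ennreal ((1 / 2 - exp (- 1)) * real n powr (\<gamma> - 1 / 2)) \<le>
    (\<integral>\<^sup>+w. ennreal (L2_norm design_law (\<lambda>x. T (regression_data n (\<lambda>_. 0)
        (\<lambda>i w. fst (w i)) (\<lambda>i w. heavy_noise \<gamma> (w i)) w) x - 0)) \<partial>sample_law)"
proof -
  let ?I = "{0<..<1 / real n}"
  let ?G = "?I \<times> {0<..}" and ?B = "?I \<times> {..0}"
  define E where "E = {w \<in> space sample_law. (\<exists>i\<in>{1..n}. w i \<in> ?G) \<and> (\<forall>i\<in>{1..n}. w i \<notin> ?B)}"
  define d where "d = regression_data n (\<lambda>_. 0) (\<lambda>i w. fst (w i)) (\<lambda>i w. heavy_noise \<gamma> (w i))"
  have sets [measurable]: "?G \<in> sets observation_law" "?B \<in> sets observation_law"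
    by (simp_all add: observation_law_def)
  have GB: "measure observation_law ?G = 1 / (2 * real n)"
      "measure observation_law ?B = 1 / (2 * real n)"
    using assms measure_design_law_interval[of "1 / real n"]
    by (simp_all add: measure_observation_law_Times measure_sign_law_halves)
  have prob_E: "1 / 2 - exp (- 1) \<le> measure sample_law E"
  proof -
    have "measure sample_law E = (1 - 1 / (2 * real n)) ^ n - (1 - 1 / (2 * real n) - 1 / (2 * real n)) ^ n"
      unfolding E_def sample_law_def
      by (subst prob_some_good_none_bad[OF observation.prob_space_axioms sets]) (auto simp only: GB)
    moreover have "1 / 2 \<le> (1 - 1 / (2 * real n)) ^ n"
      using Bernoulli_inequality[of "- 1 / (2 * real n)" n] assms by (simp add: field_simps)
    moreover have "1 - 1 / (2 * real n) - 1 / (2 * real n) = 1 - 1 / real n"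
      by simp
    moreover have "(1 - 1 / real n) ^ n \<le> exp (- 1 / real n) ^ n"
      using exp_ge_add_one_self[of "- 1 / real n"] assms by (intro power_mono) auto
    moreover have "exp (- 1 / real n) ^ n = exp (- 1)"
      using assms by (simp flip: exp_of_nat_mult)
    ultimately show ?thesis by simp
  qed
  have T_eq: "T (d w) = spike \<gamma> n" if "w \<in> E" for w
  proof (rule least_squares_estimator_pair_eq[OF T])
    show "d w \<in> space (data_space n)"
      by (auto simp: d_def regression_data_def space_PiM)
    have noise: "0 < snd (w i) \<and> real n powr \<gamma> \<le> heavy_noise \<gamma> (w i)"
      if "i \<in> {1..n}" "fst (w i) \<in> ?I" for i
    proof -
      have pos: "0 < snd (w i)"
        using \<open>w \<in> E\<close> that by (auto simp: E_def mem_Times_iff not_le)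
      have "(1 / real n) powr (- \<gamma>) \<le> fst (w i) powr (- \<gamma>)"
        using that assms by (intro powr_mono2') auto
      then show ?thesis
        using pos assms by (simp add: heavy_noise_def powr_minus powr_divide)
    qed
    show "empirical_loss n (d w) (spike \<gamma> n) < empirical_loss n (d w) (\<lambda>_. 0)"
    proof (rule empirical_loss_less_zero_fit)
      show "spike \<gamma> n (fst (d w i)) = 0 \<or>
          0 < spike \<gamma> n (fst (d w i)) \<and> spike \<gamma> n (fst (d w i)) \<le> snd (d w i)"
        if "i \<in> {1..n}" for i
        using that noise[OF that] assms
        by (auto simp: d_def regression_data_def spike_def indicator_def)
      obtain i where "i \<in> {1..n}" "w i \<in> ?G"
        using \<open>w \<in> E\<close> by (auto simp: E_def)
      then show "\<exists>i\<in>{1..n}. spike \<gamma> n (fst (d w i)) \<noteq> 0"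
        using assms
        by (intro bexI[of _ i]) (auto simp: d_def regression_data_def spike_def mem_Times_iff)
    qed
  qed
  have [measurable]: "E \<in> sets sample_law"
    unfolding E_def by measurable
  let ?r = "real n powr (\<gamma> - 1 / 2)"
  have "ennreal ((1 / 2 - exp (- 1)) * ?r) \<le> ennreal (?r * measure sample_law E)"
    using mult_left_mono[OF prob_E, of ?r] by (intro ennreal_leI) (simp only: mult.commute powr_ge_zero)
  also have "\<dots> = ennreal ?r * emeasure sample_law E"
    by (simp add: ennreal_mult sample.emeasure_eq_measure)
  also have "\<dots> = (\<integral>\<^sup>+w. ennreal ?r * indicator E w \<partial>sample_law)"
    by (simp add: nn_integral_cmult_indicator)
  also have "\<dots> \<le> (\<integral>\<^sup>+w. ennreal (L2_norm design_law (\<lambda>x. T (d w) x - 0)) \<partial>sample_law)"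
    using assms
    by (intro nn_integral_mono) (auto simp: indicator_def T_eq L2_norm_spike)
  finally show ?thesis unfolding d_def .
qed

section \<open>Exponents\<close>

lemma exponent_window:
  fixes \<alpha> p :: real
  assumes "0 < \<alpha>" "0 < p" "p < 2 + 4 / \<alpha>"
  shows "max (- 1 / (2 + \<alpha>)) (- 1 / 2 + 1 / (2 * p)) < 1 / p - 1 / 2"
proof -
  have "p * \<alpha> < 2 * \<alpha> + 4"
    using assms by (simp add: field_simps)
  then show ?thesis
    using assms by (simp add: field_simps)
qed

theorem proposition3:
  fixes \<delta> \<alpha> p :: real
  assumes "0 < \<delta>" and "\<delta> < 1 / 2"
    and "4 * \<delta> < \<alpha>" and "\<alpha> < 2"
    and "2 \<le> p" and "p < min (4 / \<delta>) ((2 + 4 / \<alpha>) / (1 + (1 + 2 / \<alpha>) * \<delta>))"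
  shows "\<exists>\<beta>>0.
    \<exists>(M :: (nat \<Rightarrow> real \<times> real) measure) (X :: nat \<Rightarrow> (nat \<Rightarrow> real \<times> real) \<Rightarrow> real)
      (\<xi> :: nat \<Rightarrow> (nat \<Rightarrow> real \<times> real) \<Rightarrow> real) (P :: real measure).
      prob_space M \<and>
      iid_sequence M (\<lambda>i w. (X i w, \<xi> i w)) \<and>
      P = distr M borel (X 1) \<and>
      (\<forall>i\<ge>1. \<not> prob_space.indep_var M borel (X i) borel (\<xi> i)) \<and>
      cond_mean_zero M (X 1) (\<xi> 1) \<and>
      Lp1_norm M p (\<xi> 1) < \<infinity> \<and>
      (\<exists>(F :: nat \<Rightarrow> (real \<Rightarrow> real) set) (f0 :: real \<Rightarrow> real) (r :: nat \<Rightarrow> real).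
        (\<forall>n\<ge>1. F n \<subseteq> L2_space P \<and> f0 \<in> F n) \<and>
        entropy_condition \<alpha> P (\<lambda>n. (\<lambda>f x. f x - f0 x) ` F n) \<and>
        (\<forall>n\<ge>1. r n \<ge> real n powr \<beta> *
                  max (real n powr (- 1 / (2 + \<alpha>))) (real n powr (- 1 / 2 + 1 / (2 * p)))) \<and>
        (\<forall>\<^sub>F n in sequentially. \<exists>T. least_squares_estimator n (F n) T \<and>
            (\<integral>\<^sup>+w. ennreal (L2_norm P (\<lambda>x. T (regression_data n f0 X \<xi> w) x - f0 x)) \<partial>M)
              \<ge> ennreal (r n)))"
proof -
  have "0 < \<alpha>" "0 < p" using assms by auto
  have "p < 2 + 4 / \<alpha>"
  proof -
    have "1 \<le> 1 + (1 + 2 / \<alpha>) * \<delta>"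
      using \<open>0 < \<delta>\<close> \<open>0 < \<alpha>\<close> by simp
    then have "(2 + 4 / \<alpha>) / (1 + (1 + 2 / \<alpha>) * \<delta>) \<le> (2 + 4 / \<alpha>) / 1"
      using \<open>0 < \<alpha>\<close> by (intro divide_left_mono) auto
    then show ?thesis using assms by simp
  qed
  (* The limiting exponent 1/p - 1/2 exceeds the exponent m of the benchmark rate by 3 * \<beta>.  One
     \<beta> keeps \<gamma> below 1/p, one is the factor in the conclusion, and the last one absorbs the
     constant in the risk bound for large n. *)
  define m where "m = max (- 1 / (2 + \<alpha>)) (- 1 / 2 + 1 / (2 * p))"
  define \<beta> where "\<beta> = (1 / p - 1 / 2 - m) / 3"
  define \<gamma> where "\<gamma> = 1 / p - \<beta>"
  have "0 < \<beta>"
    using exponent_window[OF \<open>0 < \<alpha>\<close> \<open>0 < p\<close> \<open>p < 2 + 4 / \<alpha>\<close>] by (simp add: \<beta>_def m_def)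
  have gap: "\<gamma> - 1 / 2 = \<beta> + (\<beta> + m)"
    by (simp add: \<gamma>_def \<beta>_def field_simps)
  have "- 1 / 2 \<le> m"
    using \<open>0 < p\<close> by (auto simp: m_def le_max_iff_disj)
  then have "0 < \<gamma>" using gap \<open>0 < \<beta>\<close> by linarith
  have "\<gamma> < 1 / p" using \<open>0 < \<beta>\<close> by (simp add: \<gamma>_def)
  have "1 / p \<le> 1 / 2" using \<open>2 \<le> p\<close> by (simp add: field_simps)
  then have "\<gamma> < 1" using \<open>\<gamma> < 1 / p\<close> by linarith
  let ?X = "\<lambda>(i::nat) (w :: nat \<Rightarrow> real \<times> real). fst (w i)"
  let ?\<xi> = "\<lambda>(i::nat) (w :: nat \<Rightarrow> real \<times> real). heavy_noise \<gamma> (w i)"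
  let ?F = "\<lambda>n. {\<lambda>_. 0, spike \<gamma> n}"
  let ?r = "\<lambda>n. real n powr \<beta> *
      max (real n powr (- 1 / (2 + \<alpha>))) (real n powr (- 1 / 2 + 1 / (2 * p)))"
  define c :: real where "c = 1 / 2 - exp (- 1)"
  have "0 < c"
    using exp_lower_Taylor_quadratic[of 1] by (simp add: c_def exp_minus field_simps)
  have r_eq: "?r n = real n powr (\<beta> + m)" if "1 \<le> n" for n
  proof -
    have "mono (\<lambda>u. real n powr u)"
      using that by (intro monoI powr_mono) auto
    from max_of_mono[OF this] show ?thesis
      by (simp add: powr_add m_def)
  qed
  have "\<forall>\<^sub>F n in sequentially. 1 / c \<le> real n powr \<beta>"
    using \<open>0 < \<beta>\<close> by real_asymp
  then have large: "\<forall>\<^sub>F n in sequentially. ?r n \<le> c * real n powr (\<gamma> - 1 / 2)"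
    using eventually_ge_at_top[of 1]
  proof eventually_elim
    case (elim n)
    have "1 * real n powr (\<beta> + m) \<le> (c * real n powr \<beta>) * real n powr (\<beta> + m)"
      using elim \<open>0 < c\<close> by (intro mult_right_mono) (auto simp: field_simps)
    also have "(c * real n powr \<beta>) * real n powr (\<beta> + m) = c * real n powr (\<gamma> - 1 / 2)"
      by (simp only: gap powr_add mult.assoc)
    finally show ?case
      unfolding r_eq[OF elim(2)] by simp
  qed
  have "entropy_condition \<alpha> design_law (\<lambda>n. (\<lambda>f x. f x - 0) ` ?F n)"
    using uniform_entropy_bound_pair[OF \<open>0 < \<alpha>\<close>] by (auto simp: entropy_condition_def)
  moreover have "?F n \<subseteq> L2_space design_law \<and> (\<lambda>_. 0) \<in> ?F n" for n
    using spike_in_L2_space by (auto simp: L2_space_def)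
  moreover have "\<forall>\<^sub>F n in sequentially. \<exists>T. least_squares_estimator n (?F n) T \<and>
      ennreal (?r n) \<le> (\<integral>\<^sup>+w. ennreal (L2_norm design_law
        (\<lambda>x. T (regression_data n (\<lambda>_. 0) ?X ?\<xi> w) x - 0)) \<partial>sample_law)"
    using large eventually_ge_at_top[of 1]
  proof eventually_elim
    case (elim n)
    obtain T where T: "least_squares_estimator n (?F n) T"
      using ex_least_squares_estimator_pair[of "\<lambda>_. 0" "spike \<gamma> n" n] by auto
    then show ?case
      using order_trans[OF ennreal_leI[OF elim(1)]
          least_squares_risk_spike[OF \<open>0 < \<gamma>\<close> elim(2) T, folded c_def]] by blast
  qed
  ultimately show ?thesis
    using \<open>0 < \<beta>\<close> iid_heavy_noise[of \<gamma>] not_indep_heavy_noise[OF \<open>0 < \<gamma>\<close>]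
      cond_mean_zero_heavy_noise[OF \<open>\<gamma> < 1\<close>, of 1]
      Lp1_norm_heavy_noise[OF \<open>0 < p\<close> \<open>0 < \<gamma>\<close> \<open>\<gamma> < 1 / p\<close>, of 1] distr_design[of 1]
      sample.prob_space_axioms
    by (intro exI[of _ \<beta>] conjI exI[of _ sample_law] exI[of _ ?X] exI[of _ ?\<xi>]
        exI[of _ design_law] exI[of _ ?F] exI[of _ "\<lambda>_. 0"] exI[of _ ?r]) auto
qed

end
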